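(* Let $d\geq 1$. If $\varphi$ is a partial proper $d$-edge coloring of $Q_d$ in which every color appears on at most $d-2$ edges, then $\varphi$ is avoidable.
   Context: $Q_d$ is the $d$-dimensional hypercube. A partial proper $d$-edge coloring assigns colors from $\{1,\dots,d\}$ to some edges so that adjacent colored edges receive different colors; it is avoidable if there is a proper $d$-edge coloring $f$ of $Q_d$ with colors $1,\dots,d$ such that $f(e)\neq\varphi(e)$ for every colored edge $e$. *)

theory Defs
  imports Main
begin

definition cube_vertices :: "nat \<Rightarrow> bool list set" where
  "cube_vertices d = {u. length u = d}"

definition cube_edges :: "nat \<Rightarrow> bool list set set" where
  "cube_edges d = {{u, v} | u v. u \<in> cube_vertices d \<and> v \<in> cube_vertices d \<and>
     card {i. i < d \<and> u ! i \<noteq> v ! i} = 1}"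

definition adjacent_edges :: "'v set \<Rightarrow> 'v set \<Rightarrow> bool" where
  "adjacent_edges e e' \<longleftrightarrow> e \<noteq> e' \<and> e \<inter> e' \<noteq> {}"

(* None means that the edge is uncolored. *)
definition partial_proper_edge_coloring ::
    "'v set set \<Rightarrow> nat \<Rightarrow> ('v set \<Rightarrow> nat option) \<Rightarrow> bool" where
  "partial_proper_edge_coloring E k \<phi> \<longleftrightarrow>
     dom \<phi> \<subseteq> E \<and> ran \<phi> \<subseteq> {1..k} \<and>
     (\<forall>e \<in> dom \<phi>. \<forall>e' \<in> dom \<phi>. adjacent_edges e e' \<longrightarrow> \<phi> e \<noteq> \<phi> e')"

(* The values of f outside E are irrelevant. *)
definition proper_edge_coloring :: "'v set set \<Rightarrow> nat \<Rightarrow> ('v set \<Rightarrow> nat) \<Rightarrow> bool" where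
  "proper_edge_coloring E k f \<longleftrightarrow>
     f ` E \<subseteq> {1..k} \<and> (\<forall>e \<in> E. \<forall>e' \<in> E. adjacent_edges e e' \<longrightarrow> f e \<noteq> f e')"

definition avoidable :: "'v set set \<Rightarrow> nat \<Rightarrow> ('v set \<Rightarrow> nat option) \<Rightarrow> bool" where
  "avoidable E k \<phi> \<longleftrightarrow>
     (\<exists>f. proper_edge_coloring E k f \<and> (\<forall>e \<in> dom \<phi>. \<phi> e \<noteq> Some (f e)))"

end

theory Submission
  imports Defs "HOL-Combinatorics.Permutations"
begin

text \<open>
  Pair up the directions \<open>0, \<dots>, d - 1\<close> of the cube and, at the same time, the colors, and let each
  pair of directions \<open>{i, j}\<close> use its pair of colors \<open>{c, c'}\<close>. The 4-cycles in directions \<open>i, j\<close> are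
  disjoint and each of them can be colored in two ways. Since \<open>\<phi>\<close> is proper, both ways clash with
  \<open>\<phi>\<close> only if two opposite edges of the 4-cycle have the colors \<open>c\<close> and \<open>c'\<close> in \<open>\<phi>\<close>. For even \<open>d\<close>
  there are at most \<open>d (d - 2)\<close> colored edges with \<open>d - 1\<close> parallel neighbors each, so for uniformly
  random pairings the expected number of clashes is at most \<open>(d - 2) / (d - 1) < 1\<close>.

  For odd \<open>d\<close> one direction \<open>i0\<close> gets a color \<open>c0\<close> that \<open>\<phi>\<close> does not use in this direction. The
  remaining \<open>d - 1\<close> directions and colors give an expectation of at most 1. It is less than 1 if \<open>\<phi>\<close>
  colors some edge in direction \<open>i0\<close>. Otherwise every color is admissible as \<open>c0\<close>, and taking for \<open>c0\<close>
  the color of a parallel neighbor of a colored edge destroys one potential clash.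
\<close>

section \<open>Vertices, directions and edges of the cube\<close>

text \<open>Out of range the list update does nothing, so the involution and commutation laws hold
  without side conditions.\<close>

definition flip :: "bool list \<Rightarrow> nat \<Rightarrow> bool list" where
  "flip u i = u[i := \<not> u ! i]"

definition edge :: "bool list \<Rightarrow> nat \<Rightarrow> bool list set" where
  "edge u i = {u, flip u i}"

lemma length_flip [simp]: "length (flip u i) = length u"
  by (simp add: flip_def)

lemma nth_flip: "k < length u \<Longrightarrow> flip u i ! k = (if k = i then \<not> u ! k else u ! k)"
  by (auto simp: flip_def nth_list_update)

lemma flip_flip [simp]: "flip (flip u i) i = u"
  by (rule nth_equalityI) (auto simp: nth_flip)

lemma flip_commute: "flip (flip u i) j = flip (flip u j) i"
  by (rule nth_equalityI) (auto simp: nth_flip)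

lemma flip_neq: "i < length u \<Longrightarrow> flip u i \<noteq> u"
  by (metis nth_flip)

lemma flip_inj: "i < length u \<Longrightarrow> flip u i = flip u j \<Longrightarrow> i = j"
  by (metis nth_flip)

lemma edge_flip [simp]: "edge (flip u i) i = edge u i"
  by (auto simp: edge_def)

text \<open>An edge has just two descriptions, one from each end: equal doubletons leave two ways to
  match the ends, and \<open>flip_inj\<close> recovers the direction.\<close>

lemma edge_eqD:
  assumes "edge u i = edge v j" "i < length u" "j < length v"
  shows "i = j \<and> (v = u \<or> v = flip u i)"
proof -
  have "(u = v \<and> flip u i = flip v j) \<or> (u = flip v j \<and> flip u i = v)"
    using assms(1) by (simp add: edge_def doubleton_eq_iff)
  then show ?thesis
  proof
    assume "u = v \<and> flip u i = flip v j"
    then show ?thesis using flip_inj assms by metis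
  next
    assume a: "u = flip v j \<and> flip u i = v"
    then have "flip u i = flip u j" using flip_flip by metis
    then show ?thesis using flip_inj assms a by metis
  qed
qed

lemma cube_edges_eq: "cube_edges d = {edge u i | u i. length u = d \<and> i < d}"
proof (intro equalityI subsetI)
  fix e assume "e \<in> cube_edges d"
  then obtain u v where e: "e = {u, v}" "length u = d" "length v = d"
    and card: "card {i. i < d \<and> u ! i \<noteq> v ! i} = 1"
    by (auto simp: cube_edges_def cube_vertices_def)
  obtain i where i: "{i. i < d \<and> u ! i \<noteq> v ! i} = {i}"
    using card by (auto simp: card_1_singleton_iff)
  have "i < d" using i by blast
  have "v = flip u i"
  proof (rule nth_equalityI)
    fix k assume "k < length v"
    then have "k < d" using e by simp
    then show "v ! k = flip u i ! k" using i e by (auto simp: nth_flip)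
  qed (use e in simp)
  then show "e \<in> {edge u i | u i. length u = d \<and> i < d}"
    using e \<open>i < d\<close> by (auto simp: edge_def)
next
  fix e assume "e \<in> {edge u i | u i. length u = d \<and> i < d}"
  then obtain u i where e: "e = edge u i" "length u = d" "i < d" by blast
  have "{k. k < d \<and> u ! k \<noteq> flip u i ! k} = {i}"
    using e by (auto simp: nth_flip split: if_splits)
  then have "card {k. k < d \<and> u ! k \<noteq> flip u i ! k} = 1" by simp
  then show "e \<in> cube_edges d"
    unfolding cube_edges_def cube_vertices_def mem_Collect_eq
    using e(2) by (intro exI[of _ u] exI[of _ "flip u i"]) (simp add: e(1) edge_def)
qed

lemma edge_in_cube_edges [simp]: "length u = d \<Longrightarrow> i < d \<Longrightarrow> edge u i \<in> cube_edges d"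
  by (auto simp: cube_edges_eq)

lemma finite_cube_edges [simp]: "finite (cube_edges d)"
proof -
  have "finite {u :: bool list. length u = d}"
    using finite_lists_length_eq[of "UNIV :: bool set" d] by simp
  then have "finite ({u :: bool list. length u = d} \<times> {..<d})" by simp
  moreover have "cube_edges d \<subseteq> (\<lambda>(u, i). edge u i) ` ({u. length u = d} \<times> {..<d})"
    by (auto simp: cube_edges_eq)
  ultimately show ?thesis by (rule finite_surj)
qed

lemma edge_through:
  assumes "e \<in> cube_edges d" "w \<in> e"
  obtains i where "length w = d" "i < d" "e = edge w i"
proof -
  obtain u i where "e = edge u i" "length u = d" "i < d"
    using assms(1) by (auto simp: cube_edges_eq)
  moreover have "w = u \<or> w = flip u i"
    using assms(2) calculation by (auto simp: edge_def)
  ultimately show ?thesis using that by (metis edge_flip length_flip)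
qed

section \<open>Colorings built from paired directions\<close>

text \<open>Adjacent edges leave a common vertex \<open>w\<close> in different directions, so
  properness amounts to injectivity of \<open>g w\<close>. Assumption \<open>wd\<close> makes the
  color independent of the end from which the edge is described.\<close>

lemma proper_edge_coloringI:
  fixes g :: "bool list \<Rightarrow> nat \<Rightarrow> nat"
  assumes range: "\<And>u i. length u = d \<Longrightarrow> i < d \<Longrightarrow> g u i \<in> {1..k}"
    and wd: "\<And>u i. length u = d \<Longrightarrow> i < d \<Longrightarrow> g (flip u i) i = g u i"
    and inj: "\<And>u. length u = d \<Longrightarrow> inj_on (g u) {..<d}"
  obtains f where "proper_edge_coloring (cube_edges d) k f"
    and "\<And>u i. length u = d \<Longrightarrow> i < d \<Longrightarrow> f (edge u i) = g u i"
proof -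
  define f where "f e = (THE x. \<exists>u i. length u = d \<and> i < d \<and> e = edge u i \<and> x = g u i)" for e
  have f: "f (edge u i) = g u i" if "length u = d" "i < d" for u i
    unfolding f_def
  proof (rule the_equality)
    fix x assume "\<exists>v j. length v = d \<and> j < d \<and> edge u i = edge v j \<and> x = g v j"
    then obtain v j where "length v = d" "j < d" "edge u i = edge v j" "x = g v j" by blast
    then show "x = g u i" using edge_eqD[of u i v j] that wd by auto
  qed (use that in blast)
  have "proper_edge_coloring (cube_edges d) k f"
    unfolding proper_edge_coloring_def
  proof (intro conjI ballI impI)
    show "f ` cube_edges d \<subseteq> {1..k}"
      using range f by (auto simp: cube_edges_eq)
    fix e e' assume e: "e \<in> cube_edges d" "e' \<in> cube_edges d" "adjacent_edges e e'"
    then obtain w where w: "w \<in> e" "w \<in> e'" by (auto simp: adjacent_edges_def)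
    obtain i where i: "length w = d" "i < d" "e = edge w i" using edge_through e(1) w(1) .
    obtain j where j: "j < d" "e' = edge w j" using edge_through e(2) w(2) .
    have "i \<noteq> j" using e(3) i j by (auto simp: adjacent_edges_def)
    then have "g w i \<noteq> g w j" using inj i j by (auto dest: inj_onD)
    then show "f e \<noteq> f e'" using f i j by simp
  qed
  then show ?thesis using that f by blast
qed

text \<open>Direction \<open>i\<close> has the default color \<open>\<pi> i\<close>; a fixed point
  of \<open>mate\<close> is a direction left unpaired. Wherever the default clashes with
  \<open>\<phi>\<close> on a 4-cycle, the two colors are swapped there, and \<open>paired\<close>
  rules out a clash after the swap.\<close>

lemma avoidable_of_pairing:
  assumes pp: "partial_proper_edge_coloring (cube_edges d) d \<phi>"
    and pi: "bij_betw \<pi> {..<d} {1..d}"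
    and mate: "\<And>i. i < d \<Longrightarrow> mate i < d" "\<And>i. i < d \<Longrightarrow> mate (mate i) = i"
    and fixed: "\<And>i u. i < d \<Longrightarrow> mate i = i \<Longrightarrow> length u = d \<Longrightarrow> \<phi> (edge u i) \<noteq> Some (\<pi> i)"
    and paired: "\<And>i u. i < d \<Longrightarrow> mate i \<noteq> i \<Longrightarrow> length u = d \<Longrightarrow>
      \<phi> (edge u i) = Some (\<pi> (mate i)) \<Longrightarrow> \<phi> (edge (flip u (mate i)) i) \<noteq> Some (\<pi> i)"
  shows "avoidable (cube_edges d) d \<phi>"
proof -
  \<comment> \<open>\<open>S u i\<close> means that the default clashes somewhere on the 4-cycle
    through \<open>u\<close> in directions \<open>i\<close> and \<open>mate i\<close>. For
    \<open>mate i = i\<close> this cycle collapses to a single edge.\<close>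
  define S where "S u i \<longleftrightarrow> \<phi> (edge u i) = Some (\<pi> i) \<or> \<phi> (edge (flip u (mate i)) i) = Some (\<pi> i) \<or>
    \<phi> (edge u (mate i)) = Some (\<pi> (mate i)) \<or> \<phi> (edge (flip u i) (mate i)) = Some (\<pi> (mate i))" for u i
  define g where "g u i = (if S u i then \<pi> (mate i) else \<pi> i)" for u i
  have S_mate: "S u (mate i) = S u i" if "i < d" for u i
    using mate(2)[OF that] by (auto simp: S_def)
  have S_flip: "S (flip u i) i = S u i" for u i
    unfolding S_def using flip_commute[of u i "mate i"] by auto
  have inj_pi: "i = j" if "\<pi> i = \<pi> j" "i < d" "j < d" for i j
    using that pi by (auto simp: bij_betw_def inj_on_def)
  have "inj_on (g u) {..<d}" for u
  proof (rule inj_onI)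
    fix i j assume *: "i \<in> {..<d}" "j \<in> {..<d}" "g u i = g u j"
    \<comment> \<open>At each vertex, \<open>g u\<close> is \<open>\<pi>\<close> after a map that
      swaps some pairs of directions and fixes the rest; by \<open>S_mate\<close> both directions of
      a pair swap together.\<close>
    then have "(if S u i then mate i else i) = (if S u j then mate j else j)"
      using inj_pi[of "if S u i then mate i else i" "if S u j then mate j else j"] mate(1)
      by (auto simp: g_def split: if_splits)
    then show "i = j" using * mate S_mate by (metis lessThan_iff)
  qed
  moreover have "g u i \<in> {1..d}" if "i < d" for u i
    using bij_betwE[OF pi] that mate(1) by (auto simp: g_def)
  moreover have "g (flip u i) i = g u i" for u i by (simp add: g_def S_flip)
  ultimately obtain f where f: "proper_edge_coloring (cube_edges d) d f"
    and fg: "\<And>u i. length u = d \<Longrightarrow> i < d \<Longrightarrow> f (edge u i) = g u i"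
    using proper_edge_coloringI[of d g d] by metis
  have adj: "\<phi> (edge w i) \<noteq> \<phi> (edge w j)"
    if "length w = d" "i < d" "j < d" "i \<noteq> j" "\<phi> (edge w i) \<noteq> None" for w i j
  proof
    assume eq: "\<phi> (edge w i) = \<phi> (edge w j)"
    have "edge w i \<noteq> edge w j" using edge_eqD[of w i w j] that by auto
    moreover have "w \<in> edge w i \<inter> edge w j" by (auto simp: edge_def)
    ultimately have "adjacent_edges (edge w i) (edge w j)" by (auto simp: adjacent_edges_def)
    then show False
      using pp eq that(5) unfolding partial_proper_edge_coloring_def by (metis domIff)
  qed
  have "\<phi> e \<noteq> Some (f e)" if "e \<in> dom \<phi>" for e
  proof
    assume phi: "\<phi> e = Some (f e)"
    have "e \<in> cube_edges d" using that pp by (auto simp: partial_proper_edge_coloring_def)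
    then obtain u i where e: "e = edge u i" "length u = d" "i < d"
      by (auto simp: cube_edges_eq)
    then have phi': "\<phi> (edge u i) = Some (g u i)" using phi fg by simp
    show False
    proof (cases "S u i")
      case False
      then have "g u i = \<pi> i" by (simp add: g_def)
      then show False using phi' False unfolding S_def by metis
    next
      case True
      show False
      proof (cases "mate i = i")
        case True
        then show False using \<open>S u i\<close> fixed e by (auto simp: S_def)
      next
        case False
        have phi'': "\<phi> (edge u i) = Some (\<pi> (mate i))" using phi' \<open>S u i\<close> by (simp add: g_def)
        \<comment> \<open>Since \<open>edge u i\<close> has the color \<open>\<pi> (mate i)\<close>,
          it lacks \<open>\<pi> i\<close>, and properness keeps \<open>\<pi> (mate i)\<close> off
          the two edges meeting it in direction \<open>mate i\<close>. The default clash is thus on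
          the opposite edge, which \<open>paired\<close> excludes.\<close>
        have "\<phi> (edge u i) \<noteq> Some (\<pi> i)" using phi'' inj_pi e mate False by auto
        moreover have "\<phi> (edge u (mate i)) \<noteq> Some (\<pi> (mate i))"
          using adj[of u i "mate i"] phi'' e mate False by auto
        moreover have "\<phi> (edge (flip u i) (mate i)) \<noteq> Some (\<pi> (mate i))"
          using adj[of "flip u i" i "mate i"] phi'' e mate False by auto
        ultimately show False using \<open>S u i\<close> paired[OF e(3) False e(2) phi''] by (auto simp: S_def)
      qed
    qed
  qed
  then show ?thesis using f by (auto simp: avoidable_def)
qed

section \<open>Averaging over pairings\<close>

text \<open>Composing with the inverse of one member \<open>\<rho>\<close> maps the set injectively
  into the permutations that fix \<open>a\<close> and \<open>b\<close>.\<close>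

lemma card_permutes_two_values_le:
  assumes "finite P" "a \<in> P" "b \<in> P" "a \<noteq> b"
  shows "card {\<sigma>. \<sigma> permutes P \<and> \<sigma> a = x \<and> \<sigma> b = y} \<le> fact (card P - 2)" (is "card ?A \<le> _")
proof (cases "?A = {}")
  case False
  then obtain \<rho> where \<rho>: "\<rho> permutes P" "\<rho> a = x" "\<rho> b = y" by auto
  have "card ?A \<le> card {\<sigma>. \<sigma> permutes (P - {a, b})}"
  proof (rule card_inj_on_le[where f = "\<lambda>\<sigma>. inv \<rho> \<circ> \<sigma>"])
    show "inj_on (\<lambda>\<sigma>. inv \<rho> \<circ> \<sigma>) ?A"
      by (rule inj_on_inverseI[where g = "\<lambda>\<sigma>. \<rho> \<circ> \<sigma>"]) (simp add: o_assoc permutes_inv_o(1)[OF \<rho>(1)])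
    show "(\<lambda>\<sigma>. inv \<rho> \<circ> \<sigma>) ` ?A \<subseteq> {\<sigma>. \<sigma> permutes (P - {a, b})}"
    proof clarify
      fix \<sigma> assume \<sigma>: "\<sigma> permutes P" "x = \<sigma> a" "y = \<sigma> b"
      have "inv \<rho> \<circ> \<sigma> permutes P" using \<sigma> \<rho> by (simp add: permutes_compose permutes_inv)
      moreover have "inv \<rho> (\<sigma> a) = a" "inv \<rho> (\<sigma> b) = b"
        using \<sigma> \<rho> permutes_inverses(2)[OF \<rho>(1)] by metis+
      ultimately show "inv \<rho> \<circ> \<sigma> permutes (P - {a, b})"
        unfolding permutes_def by (metis Diff_iff comp_apply insertE singletonD)
    qed
    show "finite {\<sigma>. \<sigma> permutes (P - {a, b})}" using assms by (simp add: finite_permutations)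
  qed
  also have "\<dots> = fact (card P - 2)"
    using assms by (subst card_permutations[OF refl]) (auto simp: card_Diff_subset numeral_2_eq_2)
  finally show ?thesis .
next
  case True
  show ?thesis unfolding True by simp
qed

text \<open>Averaging over all pairs of bijections: for a fixed position, the quadruple of values below is
  uniformly distributed over \<open>(n (n - 1))\<^sup>2\<close> possibilities.\<close>

lemma exists_bijections_avoiding:
  fixes D :: "'a set" and C :: "'b set" and n :: nat and B :: "('a \<times> 'a \<times> 'b \<times> 'b) set"
  assumes D: "finite D" "card D = n" and C: "finite C" "card C = n" and B: "finite B"
    and card: "n * card B < (n * (n - 1)) ^ 2"
    and mu: "\<And>a. a < n \<Longrightarrow> \<mu> a < n" "\<And>a. a < n \<Longrightarrow> \<mu> a \<noteq> a"
  obtains s t where "bij_betw s {..<n} D" "bij_betw t {..<n} C"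
    "\<And>a. a < n \<Longrightarrow> (s a, s (\<mu> a), t (\<mu> a), t a) \<notin> B"
proof -
  obtain hD where hD: "bij_betw hD {..<n} D"
    using ex_bij_betw_nat_finite[OF D(1)] D(2) by (auto simp: atLeast0LessThan)
  obtain hC where hC: "bij_betw hC {..<n} C"
    using ex_bij_betw_nat_finite[OF C(1)] C(2) by (auto simp: atLeast0LessThan)
  let ?P = "{\<sigma>. \<sigma> permutes {..<n}}"
  \<comment> \<open>Through the enumerations \<open>hD\<close> and \<open>hC\<close>, permutations
    stand for bijections; \<open>A1 a q \<times> A2 a q\<close> is the event that position
    \<open>a\<close> shows the quadruple \<open>q\<close>.\<close>
  define A1 where "A1 a q = (case q of (i, j, c, c') \<Rightarrow>
    {\<sigma> \<in> ?P. hD (\<sigma> a) = i \<and> hD (\<sigma> (\<mu> a)) = j})" for a and q :: "'a \<times> 'a \<times> 'b \<times> 'b"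
  define A2 where "A2 a q = (case q of (i, j, c, c') \<Rightarrow>
    {\<sigma> \<in> ?P. hC (\<sigma> (\<mu> a)) = c \<and> hC (\<sigma> a) = c'})" for a and q :: "'a \<times> 'a \<times> 'b \<times> 'b"
  have bound: "card {\<sigma> \<in> ?P. h (\<sigma> a) = i \<and> h (\<sigma> b) = j} \<le> fact (n - 2)"
    if h: "bij_betw h {..<n} X" and ab: "a < n" "b < n" "a \<noteq> b" for h :: "nat \<Rightarrow> 'c" and X a b i j
  proof -
    have "{\<sigma> \<in> ?P. h (\<sigma> a) = i \<and> h (\<sigma> b) = j} \<subseteq>
      {\<sigma>. \<sigma> permutes {..<n} \<and> \<sigma> a = inv_into {..<n} h i \<and> \<sigma> b = inv_into {..<n} h j}"
    proof clarify
      fix \<sigma> assume "\<sigma> permutes {..<n}"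
      then have "\<sigma> a \<in> {..<n}" "\<sigma> b \<in> {..<n}" using ab permutes_in_image[of \<sigma> "{..<n}"] by simp_all
      then show "\<sigma> a = inv_into {..<n} h (h (\<sigma> a)) \<and> \<sigma> b = inv_into {..<n} h (h (\<sigma> b))"
        using h by (simp add: bij_betw_def inv_into_f_f)
    qed
    then have "card {\<sigma> \<in> ?P. h (\<sigma> a) = i \<and> h (\<sigma> b) = j} \<le>
      card {\<sigma>. \<sigma> permutes {..<n} \<and> \<sigma> a = inv_into {..<n} h i \<and> \<sigma> b = inv_into {..<n} h j}"
      by (rule card_mono[rotated]) (auto intro: rev_finite_subset[OF finite_permutations[of "{..<n}"]])
    also have "\<dots> \<le> fact (n - 2)"
      using card_permutes_two_values_le[of "{..<n}" a b] ab by simp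
    finally show ?thesis .
  qed
  have b1: "card (A1 a q) \<le> fact (n - 2)" if "a < n" for a q
    using bound[OF hD that mu(1)[OF that] mu(2)[OF that, symmetric]] by (simp add: A1_def split: prod.split)
  have b2: "card (A2 a q) \<le> fact (n - 2)" if "a < n" for a q
    using bound[OF hC mu(1)[OF that] that mu(2)[OF that]] by (simp add: A2_def split: prod.split)
  \<comment> \<open>Union bound: each of the \<open>n * card B\<close> events contains at most
    \<open>fact (n - 2) * fact (n - 2)\<close> of the \<open>fact n * fact n\<close> pairs, too few
    to cover all.\<close>
  have "\<not> ?P \<times> ?P \<subseteq> (\<Union>a\<in>{..<n}. \<Union>q\<in>B. A1 a q \<times> A2 a q)" (is "\<not> _ \<subseteq> ?U")
  proof
    assume sub: "?P \<times> ?P \<subseteq> ?U"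
    have "n \<ge> 2" using card by (cases n; cases "n - 1") auto
    have finA: "finite (A1 a q)" "finite (A2 a q)" for a q
      by (auto simp: A1_def A2_def finite_permutations split: prod.split)
    have "fact n * fact n = card (?P \<times> ?P)"
      by (simp add: card_cartesian_product card_permutations[OF refl])
    also have "\<dots> \<le> card ?U"
      by (rule card_mono[OF _ sub]) (use B finA in auto)
    also have "\<dots> \<le> (\<Sum>a<n. card (\<Union>q\<in>B. A1 a q \<times> A2 a q))"
      by (rule card_UN_le) simp
    also have "\<dots> \<le> (\<Sum>a<n. \<Sum>q\<in>B. card (A1 a q \<times> A2 a q))"
      by (intro sum_mono card_UN_le B)
    also have "\<dots> \<le> (\<Sum>a<n. \<Sum>q\<in>B. fact (n - 2) * fact (n - 2))"
      by (intro sum_mono) (simp add: card_cartesian_product mult_mono b1 b2)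
    also have "\<dots> = (n * card B) * (fact (n - 2) * fact (n - 2))" by simp
    also have "\<dots> < (n * (n - 1)) ^ 2 * (fact (n - 2) * fact (n - 2))"
      using card by (intro mult_strict_right_mono) auto
    also have "\<dots> = fact n * fact n"
    proof -
      obtain m where "n = Suc (Suc m)" using \<open>n \<ge> 2\<close> by (metis add_2_eq_Suc le_Suc_ex)
      then show ?thesis by (simp add: power2_eq_square algebra_simps)
    qed
    finally show False by simp
  qed
  then obtain \<sigma> \<tau> where st: "\<sigma> permutes {..<n}" "\<tau> permutes {..<n}" "(\<sigma>, \<tau>) \<notin> ?U" by blast
  show ?thesis
  proof (rule that)
    show "bij_betw (hD \<circ> \<sigma>) {..<n} D" using st(1) hD by (metis bij_betw_trans permutes_imp_bij)
    show "bij_betw (hC \<circ> \<tau>) {..<n} C" using st(2) hC by (metis bij_betw_trans permutes_imp_bij)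
    fix a assume "a < n"
    then show "((hD \<circ> \<sigma>) a, (hD \<circ> \<sigma>) (\<mu> a), (hC \<circ> \<tau>) (\<mu> a), (hC \<circ> \<tau>) a) \<notin> B"
      using st by (auto simp: A1_def A2_def)
  qed
qed

text \<open>Positions are paired as \<open>2k\<close>, \<open>2k + 1\<close>, which stays below
  \<open>n\<close> because \<open>n\<close> is even. Then \<open>mate\<close> is this pairing
  conjugated by \<open>s\<close>, and \<open>\<pi>\<close> is \<open>t\<close> after the inverse of
  \<open>s\<close>.\<close>

lemma exists_pairing_avoiding:
  fixes D :: "'a set" and C :: "'b set" and n :: nat and B :: "('a \<times> 'a \<times> 'b \<times> 'b) set"
  assumes D: "finite D" "card D = n" and C: "finite C" "card C = n" and B: "finite B"
    and card: "card B < n * (n - 1) ^ 2" and "even n"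
  obtains mate \<pi> where "bij_betw \<pi> D C" "\<And>i. i \<in> D \<Longrightarrow> mate i \<in> D"
    "\<And>i. i \<in> D \<Longrightarrow> mate i \<noteq> i" "\<And>i. i \<in> D \<Longrightarrow> mate (mate i) = i"
    "\<And>i. i \<in> D \<Longrightarrow> (i, mate i, \<pi> (mate i), \<pi> i) \<notin> B"
proof -
  define \<mu> where "\<mu> a = (if even a then Suc a else a - 1)" for a :: nat
  have mu: "\<mu> a < n" if "a < n" for a
    using that \<open>even n\<close> by (auto simp: \<mu>_def) (metis Suc_lessI even_Suc)
  have mu_neq: "\<mu> a \<noteq> a" for a by (cases a) (auto simp: \<mu>_def)
  have mu_mu: "\<mu> (\<mu> a) = a" for a by (cases a) (auto simp: \<mu>_def)
  have "n > 0" using card by (cases n) auto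
  then have "n * card B < (n * (n - 1)) ^ 2"
    using mult_strict_left_mono[OF card, of n] by (simp add: power2_eq_square ac_simps)
  then obtain s t where s: "bij_betw s {..<n} D" and t: "bij_betw t {..<n} C"
    and st: "\<And>a. a < n \<Longrightarrow> (s a, s (\<mu> a), t (\<mu> a), t a) \<notin> B"
    using exists_bijections_avoiding[OF D C B _ mu mu_neq] by blast
  define r where "r = inv_into {..<n} s"
  have r: "bij_betw r D {..<n}" unfolding r_def using s by (rule bij_betw_inv_into)
  have rs: "r (s a) = a" if "a < n" for a
    using s that by (simp add: r_def bij_betw_def inv_into_f_f)
  have sr: "s (r i) = i" if "i \<in> D" for i
    using s that by (simp add: r_def bij_betw_def f_inv_into_f)
  have r_less: "r i < n" if "i \<in> D" for i using bij_betwE[OF r] that by auto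
  have s_in: "s a \<in> D" if "a < n" for a using bij_betwE[OF s] that by auto
  show ?thesis
  proof (rule that[of "t \<circ> r" "\<lambda>i. s (\<mu> (r i))"])
    show "bij_betw (t \<circ> r) D C" using r t by (rule bij_betw_trans)
    fix i assume i: "i \<in> D"
    show "s (\<mu> (r i)) \<in> D" using i by (simp add: s_in mu r_less)
    show "s (\<mu> (r i)) \<noteq> i" using i mu_neq rs mu r_less by metis
    show "s (\<mu> (r (s (\<mu> (r i))))) = i" using i by (simp add: rs mu r_less mu_mu sr)
    show "(i, s (\<mu> (r i)), (t \<circ> r) (s (\<mu> (r i))), (t \<circ> r) i) \<notin> B"
      using st[of "r i"] i by (simp add: rs sr mu r_less)
  qed
qed

section \<open>Counting potential clashes\<close>

text \<open>The direction is stored with the edge because a set of two vertices does not display it;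
  \<open>inj_on_fst_colored_in\<close> shows that no edge is counted twice.\<close>

definition colored_in ::
    "nat \<Rightarrow> (bool list set \<Rightarrow> nat option) \<Rightarrow> nat set \<Rightarrow> nat set \<Rightarrow> (bool list set \<times> nat) set" where
  "colored_in d \<phi> D C = {(edge u i, i) | u i. length u = d \<and> i < d \<and> i \<in> D \<and> \<phi> (edge u i) \<in> Some ` C}"

text \<open>A conflict could spoil both colorings of a 4-cycle. Conflicts are ordered: a pair of
  opposite edges occurs once from each of its edges.\<close>

definition conflicts ::
    "nat \<Rightarrow> (bool list set \<Rightarrow> nat option) \<Rightarrow> nat set \<Rightarrow> nat set \<Rightarrow> ((bool list set \<times> nat) \<times> nat) set" where
  "conflicts d \<phi> D C = {((e, i), j) | e i j. (e, i) \<in> colored_in d \<phi> D C \<and> j \<in> D - {i} \<and>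
     \<phi> ((\<lambda>u. flip u j) ` e) \<in> Some ` C \<and> \<phi> ((\<lambda>u. flip u j) ` e) \<noteq> \<phi> e}"

lemma flip_image_edge: "(\<lambda>u. flip u j) ` edge u i = edge (flip u j) i"
  by (auto simp: edge_def flip_commute[of u i j])

lemma fst_colored_in: "fst ` colored_in d \<phi> D C \<subseteq> (\<Union>c\<in>C. {e \<in> cube_edges d. \<phi> e = Some c})"
  by (auto simp: colored_in_def)

lemma inj_on_fst_colored_in: "inj_on fst (colored_in d \<phi> D C)"
proof (rule inj_onI)
  fix p q assume "p \<in> colored_in d \<phi> D C" "q \<in> colored_in d \<phi> D C" "fst p = fst q"
  then obtain u i v j where "p = (edge u i, i)" "q = (edge v j, j)" "length u = d" "length v = d"
    "i < d" "j < d" "edge u i = edge v j" by (auto simp: colored_in_def)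
  then show "p = q" using edge_eqD[of u i v j] by simp
qed

lemma finite_colored_in [simp]: "finite (colored_in d \<phi> D C)"
proof -
  have "fst ` colored_in d \<phi> D C \<subseteq> cube_edges d" using fst_colored_in by fast
  then show ?thesis
    by (rule finite_imageD[OF finite_subset[OF _ finite_cube_edges] inj_on_fst_colored_in])
qed

text \<open>The color classes have at most \<open>card C * k\<close> edges together, and each edge
  in \<open>R\<close> belongs to one of them without being counted by
  \<open>colored_in\<close>.\<close>

lemma card_colored_in_le:
  assumes "finite C" and bound: "\<And>c. c \<in> C \<Longrightarrow> card {e \<in> cube_edges d. \<phi> e = Some c} \<le> k"
    and "fst ` colored_in d \<phi> D C \<subseteq> (\<Union>c\<in>C. {e \<in> cube_edges d. \<phi> e = Some c}) - R"
    and "R \<subseteq> (\<Union>c\<in>C. {e \<in> cube_edges d. \<phi> e = Some c})"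
  shows "card (colored_in d \<phi> D C) + card R \<le> card C * k"
proof -
  let ?U = "\<Union>c\<in>C. {e \<in> cube_edges d. \<phi> e = Some c}"
  have fin: "finite ?U" using assms(1) by simp
  have "card (colored_in d \<phi> D C) = card (fst ` colored_in d \<phi> D C)"
    by (simp add: card_image inj_on_fst_colored_in)
  also have "\<dots> \<le> card (?U - R)" by (intro card_mono assms) (use fin in simp)
  also have "\<dots> = card ?U - card R"
    using assms(4) fin by (meson card_Diff_subset finite_subset)
  finally have "card (colored_in d \<phi> D C) + card R \<le> card ?U"
    using card_mono[OF fin assms(4)] by simp
  also have "\<dots> \<le> (\<Sum>c\<in>C. card {e \<in> cube_edges d. \<phi> e = Some c})"
    by (rule card_UN_le[OF assms(1)])
  also have "\<dots> \<le> card C * k" using sum_bounded_above[of C _ k] bound by simp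
  finally show ?thesis .
qed

lemma conflicts_subset: "conflicts d \<phi> D C \<subseteq> Sigma (colored_in d \<phi> D C) (\<lambda>p. D - {snd p})"
  by (auto simp: conflicts_def)

lemma card_Sigma_colored_in:
  assumes "finite D"
  shows "card (Sigma (colored_in d \<phi> D C) (\<lambda>p. D - {snd p})) = card (colored_in d \<phi> D C) * (card D - 1)"
proof -
  have "card (Sigma (colored_in d \<phi> D C) (\<lambda>p. D - {snd p})) =
    (\<Sum>p\<in>colored_in d \<phi> D C. card (D - {snd p}))"
    using assms by (intro card_SigmaI) auto
  also have "\<dots> = (\<Sum>p\<in>colored_in d \<phi> D C. card D - 1)"
    by (rule sum.cong) (auto simp: colored_in_def)
  finally show ?thesis by simp
qed

text \<open>Directions in \<open>D\<close> are paired so as to avoid every conflict; the others stay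
  unpaired and get colors from \<open>\<rho>\<close>, which \<open>free\<close> makes safe.\<close>

lemma avoidable_of_few_conflicts:
  assumes pp: "partial_proper_edge_coloring (cube_edges d) d \<phi>"
    and D: "D \<subseteq> {..<d}" "card D = n" and C: "C \<subseteq> {1..d}" "card C = n" and "even n"
    and few: "card (conflicts d \<phi> D C) < n * (n - 1) ^ 2"
    and rest: "bij_betw \<rho> ({..<d} - D) ({1..d} - C)"
    and free: "\<And>i u. i < d \<Longrightarrow> i \<notin> D \<Longrightarrow> length u = d \<Longrightarrow> \<phi> (edge u i) \<noteq> Some (\<rho> i)"
  shows "avoidable (cube_edges d) d \<phi>"
proof -
  have finD: "finite D" and finC: "finite C" using D C finite_subset by auto
  \<comment> \<open>\<open>B\<close> forgets where in the cube a conflict lies, since a pairing sees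
    only its directions and colors. Merging conflicts cannot raise the count.\<close>
  define B where "B = (\<lambda>((e, i), j). (i, j, the (\<phi> e), the (\<phi> ((\<lambda>u. flip u j) ` e)))) ` conflicts d \<phi> D C"
  have finZ: "finite (conflicts d \<phi> D C)"
    using finD by (intro finite_subset[OF conflicts_subset] finite_SigmaI) auto
  have "finite B" using finZ by (simp add: B_def)
  moreover have "card B < n * (n - 1) ^ 2"
    unfolding B_def by (rule le_less_trans[OF card_image_le[OF finZ] few])
  ultimately obtain mate \<pi> where pi: "bij_betw \<pi> D C" and mate: "\<And>i. i \<in> D \<Longrightarrow> mate i \<in> D"
    "\<And>i. i \<in> D \<Longrightarrow> mate i \<noteq> i" "\<And>i. i \<in> D \<Longrightarrow> mate (mate i) = i"
    and avoid: "\<And>i. i \<in> D \<Longrightarrow> (i, mate i, \<pi> (mate i), \<pi> i) \<notin> B"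
    using exists_pairing_avoiding[OF finD D(2) finC C(2), of B] \<open>even n\<close> by metis
  define mate' where "mate' i = (if i \<in> D then mate i else i)" for i
  define \<pi>' where "\<pi>' i = (if i \<in> D then \<pi> i else \<rho> i)" for i
  have "bij_betw \<pi>' (D \<union> ({..<d} - D)) (C \<union> ({1..d} - C))"
  proof (rule bij_betw_combine)
    show "bij_betw \<pi>' D C" using pi by (subst bij_betw_cong[of _ _ \<pi>]) (auto simp: \<pi>'_def)
    show "bij_betw \<pi>' ({..<d} - D) ({1..d} - C)"
      using rest by (subst bij_betw_cong[of _ _ \<rho>]) (auto simp: \<pi>'_def)
  qed auto
  then have pi': "bij_betw \<pi>' {..<d} {1..d}" using D C by (simp add: Un_absorb1)
  show ?thesis
  proof (rule avoidable_of_pairing[OF pp pi', of mate'])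
    fix i assume i: "i < d"
    show "mate' i < d" using i mate D by (auto simp: mate'_def)
    show "mate' (mate' i) = i" using mate by (auto simp: mate'_def)
    fix u :: "bool list" assume u: "length u = d"
    show "\<phi> (edge u i) \<noteq> Some (\<pi>' i)" if "mate' i = i"
      using that mate free i u by (auto simp: mate'_def \<pi>'_def split: if_splits)
    show "\<phi> (edge (flip u (mate' i)) i) \<noteq> Some (\<pi>' i)"
      if neq: "mate' i \<noteq> i" and phi: "\<phi> (edge u i) = Some (\<pi>' (mate' i))"
    proof
      assume phi': "\<phi> (edge (flip u (mate' i)) i) = Some (\<pi>' i)"
      have iD: "i \<in> D" using neq by (auto simp: mate'_def split: if_splits)
      then have p: "\<phi> (edge u i) = Some (\<pi> (mate i))" "\<phi> (edge (flip u (mate i)) i) = Some (\<pi> i)"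
        using phi phi' mate by (auto simp: mate'_def \<pi>'_def)
      have in_C: "\<pi> i \<in> C" "\<pi> (mate i) \<in> C" using bij_betwE[OF pi] iD mate by auto
      have "\<pi> i \<noteq> \<pi> (mate i)" using pi iD mate by (metis bij_betw_def inj_onD)
      then have "((edge u i, i), mate i) \<in> conflicts d \<phi> D C"
        using p in_C iD mate i u by (auto simp: conflicts_def colored_in_def flip_image_edge)
      then have "(i, mate i, \<pi> (mate i), \<pi> i) \<in> B"
        unfolding B_def by (rule rev_image_eqI) (simp add: p flip_image_edge)
      then show False using avoid iD by blast
    qed
  qed
qed

section \<open>Even and odd dimension\<close>

theorem theorem4p11:
  fixes d :: nat and \<phi> :: "bool list set \<Rightarrow> nat option"
  assumes "d \<ge> 1"
    and "partial_proper_edge_coloring (cube_edges d) d \<phi>"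
    and "\<forall>c \<in> {1..d}. int (card {e \<in> cube_edges d. \<phi> e = Some c}) \<le> int d - 2"
  shows "avoidable (cube_edges d) d \<phi>"
proof -
  \<comment> \<open>For \<open>d = 1\<close> the integer bound would be negative, so
    \<open>d \<ge> 2\<close> and the truncated \<open>d - 2\<close> below is exact.\<close>
  have "int (card {e \<in> cube_edges d. \<phi> e = Some 1}) \<le> int d - 2" using assms by auto
  then have "d \<ge> 2" by linarith
  have bound: "card {e \<in> cube_edges d. \<phi> e = Some c} \<le> d - 2" if "c \<in> {1..d}" for c
    using bspec[OF assms(3) that] by linarith
  have conf_le: "card (conflicts d \<phi> D C) \<le> card (colored_in d \<phi> D C) * (card D - 1)"
    if "finite D" for D C
  proof -
    have "card (conflicts d \<phi> D C) \<le> card (Sigma (colored_in d \<phi> D C) (\<lambda>p. D - {snd p}))"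
      using that by (intro card_mono conflicts_subset finite_SigmaI) auto
    then show ?thesis unfolding card_Sigma_colored_in[OF that] .
  qed
  show ?thesis
  proof (cases "even d")
    case True
    let ?D = "{..<d}" and ?C = "{1..d}"
    have "card (colored_in d \<phi> ?D ?C) + card ({} :: bool list set set) \<le> card ?C * (d - 2)"
      using fst_colored_in by (intro card_colored_in_le bound) auto
    then have "card (colored_in d \<phi> ?D ?C) \<le> d * (d - 2)" by simp
    then have "card (conflicts d \<phi> ?D ?C) \<le> d * (d - 2) * (d - 1)"
      using conf_le[of ?D ?C] by (metis card_lessThan finite_lessThan le_trans mult_le_mono1)
    also have "\<dots> < d * (d - 1) * (d - 1)"
      using \<open>d \<ge> 2\<close> by (intro mult_strict_right_mono mult_strict_left_mono) auto
    finally have "card (conflicts d \<phi> ?D ?C) < d * (d - 1) ^ 2"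
      by (simp add: power2_eq_square algebra_simps)
    then show ?thesis
      using True by (intro avoidable_of_few_conflicts[OF assms(2), of ?D d ?C]) auto
  next
    case False
    then have "d \<ge> 3" using \<open>d \<ge> 2\<close> by (cases "d = 2") auto
    \<comment> \<open>With \<open>n = d - 1\<close> the bound to beat is what the crude count gives:
      \<open>(d - 1) * (d - 2)\<close> colored edges with \<open>d - 2\<close> directions each.
      Every case must save something.\<close>
    have reduce: ?thesis
      if ic: "i0 < d" "c0 \<in> {1..d}" and free: "\<And>u. length u = d \<Longrightarrow> \<phi> (edge u i0) \<noteq> Some c0"
        and lt: "card (conflicts d \<phi> ({..<d} - {i0}) ({1..d} - {c0})) < (d - 1) * (d - 2) * (d - 2)"
      for i0 c0
    proof (rule avoidable_of_few_conflicts[OF assms(2), of "{..<d} - {i0}" "d - 1" "{1..d} - {c0}" "\<lambda>_. c0"])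
      show "card (conflicts d \<phi> ({..<d} - {i0}) ({1..d} - {c0})) < (d - 1) * (d - 1 - 1) ^ 2"
        using lt by (simp add: power2_eq_square ac_simps numeral_2_eq_2)
      have "{..<d} - ({..<d} - {i0}) = {i0}" "{1..d} - ({1..d} - {c0}) = {c0}" using ic by auto
      then show "bij_betw (\<lambda>_. c0) ({..<d} - ({..<d} - {i0})) ({1..d} - ({1..d} - {c0}))"
        by (simp add: bij_betw_def)
    qed (use ic free False in auto)
    have colored_le: "card (colored_in d \<phi> ({..<d} - {i0}) ({1..d} - {c0})) + card R \<le> (d - 1) * (d - 2)"
      if "c0 \<in> {1..d}" "R \<subseteq> (\<Union>c\<in>{1..d} - {c0}. {e \<in> cube_edges d. \<phi> e = Some c})"
        "R \<inter> fst ` colored_in d \<phi> ({..<d} - {i0}) ({1..d} - {c0}) = {}" for i0 c0 R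
    proof -
      have "fst ` colored_in d \<phi> ({..<d} - {i0}) ({1..d} - {c0}) \<subseteq>
          (\<Union>c\<in>{1..d} - {c0}. {e \<in> cube_edges d. \<phi> e = Some c}) - R"
      proof (intro subsetI DiffI)
        fix x assume x: "x \<in> fst ` colored_in d \<phi> ({..<d} - {i0}) ({1..d} - {c0})"
        then show "x \<in> (\<Union>c\<in>{1..d} - {c0}. {e \<in> cube_edges d. \<phi> e = Some c})"
          by (rule subsetD[OF fst_colored_in])
        show "x \<notin> R" using x that(3) by (metis IntI emptyE)
      qed
      then have "card (colored_in d \<phi> ({..<d} - {i0}) ({1..d} - {c0})) + card R \<le> card ({1..d} - {c0}) * (d - 2)"
        using that(2) bound by (intro card_colored_in_le) auto
      then show ?thesis using that(1) by simp
    qed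
    have ran: "c \<in> {1..d}" if "\<phi> e = Some c" for e c
      using assms(2) that unfolding partial_proper_edge_coloring_def by (auto simp: ran_def)
    show ?thesis
    proof (cases "\<exists>i0 < d. \<exists>c0 \<in> {1..d}. (\<forall>u. length u = d \<longrightarrow> \<phi> (edge u i0) \<noteq> Some c0) \<and>
        (\<exists>u. length u = d \<and> \<phi> (edge u i0) \<noteq> None)")
      case True
      then obtain i0 c0 u c where ic: "i0 < d" "c0 \<in> {1..d}"
        and free: "\<And>u. length u = d \<Longrightarrow> \<phi> (edge u i0) \<noteq> Some c0"
        and u: "length u = d" "\<phi> (edge u i0) = Some c" by blast
      let ?D = "{..<d} - {i0}" and ?C = "{1..d} - {c0}"
      have "c \<in> ?C" using ran u free by auto
      \<comment> \<open>This edge has a color in \<open>?C\<close> but a direction outside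
        \<open>?D\<close>, so it can serve as \<open>R\<close> and lowers the count of colored
        edges.\<close>
      then have "{edge u i0} \<subseteq> (\<Union>c\<in>?C. {e \<in> cube_edges d. \<phi> e = Some c})"
        using u ic by auto
      moreover have "{edge u i0} \<inter> fst ` colored_in d \<phi> ?D ?C = {}"
      proof -
        have "i = i0" if "edge u i0 = edge v i" "length v = d" "i < d" for v i
          using edge_eqD[of u i0 v i] that u ic by simp
        then show ?thesis by (auto simp: colored_in_def)
      qed
      ultimately have "card (colored_in d \<phi> ?D ?C) < (d - 1) * (d - 2)"
        using colored_le[OF ic(2), of "{edge u i0}" i0] by simp
      then have strict: "card (colored_in d \<phi> ?D ?C) * (d - 2) < (d - 1) * (d - 2) * (d - 2)"
        using \<open>d \<ge> 3\<close> by (intro mult_strict_right_mono) auto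
      have "card (conflicts d \<phi> ?D ?C) \<le> card (colored_in d \<phi> ?D ?C) * (card ?D - 1)"
        by (rule conf_le) simp
      also have "card ?D - 1 = d - 2" using ic by simp
      also note strict
      finally show ?thesis using reduce ic free by blast
    next
      case dichotomy: False
      \<comment> \<open>Color 1 has at most \<open>d - 2\<close> edges, so it misses some
        direction.\<close>
      obtain i0 where i0: "i0 < d" and free1: "\<And>u. length u = d \<Longrightarrow> \<phi> (edge u i0) \<noteq> Some 1"
      proof (rule ccontr)
        assume "\<not> thesis"
        then have "\<forall>i<d. \<exists>u. length u = d \<and> \<phi> (edge u i) = Some 1" using that by blast
        then obtain w where w: "\<And>i. i < d \<Longrightarrow> length (w i) = d \<and> \<phi> (edge (w i) i) = Some 1" by metis
        have "inj_on (\<lambda>i. edge (w i) i) {..<d}"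
          by (rule inj_onI) (use w edge_eqD in fastforce)
        then have "card {..<d} \<le> card {e \<in> cube_edges d. \<phi> e = Some 1}"
          by (rule card_inj_on_le) (use w in auto)
        then show False using bound[of 1] \<open>d \<ge> 2\<close> by simp
      qed
      \<comment> \<open>A colored edge in direction \<open>i0\<close> would, with color 1 as
        \<open>c0\<close>, satisfy the previous case. Hence every color is now free for
        \<open>i0\<close>.\<close>
      have empty: "\<phi> (edge u i0) = None" if "length u = d" for u
        using dichotomy i0 free1 that assms(1) by fastforce
      show ?thesis
      proof (cases "\<exists>e. \<phi> e \<noteq> None")
        case False
        then have "conflicts d \<phi> ({..<d} - {i0}) ({1..d} - {1}) = {}"
          by (auto simp: conflicts_def colored_in_def)
        then show ?thesis using reduce[OF i0, of 1] free1 \<open>d \<ge> 3\<close> by simp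
      next
        case True
        then obtain e c where e: "\<phi> e = Some c" by auto
        then have "e \<in> cube_edges d" using assms(2) by (auto simp: partial_proper_edge_coloring_def)
        then obtain u i where u: "e = edge u i" "length u = d" "i < d" by (auto simp: cube_edges_eq)
        have "i \<noteq> i0" using empty e u by auto
        \<comment> \<open>As \<open>d \<ge> 3\<close>, there is a third direction \<open>j\<close>,
          so that \<open>i\<close> and \<open>j\<close> both remain after removing
          \<open>i0\<close>.\<close>
        have "card {i, i0} < card {..<d}" using \<open>d \<ge> 3\<close> \<open>i \<noteq> i0\<close> by simp
        then obtain j where j: "j < d" "j \<noteq> i" "j \<noteq> i0"
          by (metis card_mono finite.emptyI finite.insertI insertCI leD lessThan_iff subsetI)
        let ?e' = "(\<lambda>u. flip u j) ` e"
        \<comment> \<open>Set aside the color of the neighbor \<open>?e'\<close> if it has one other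
          than \<open>c\<close>, and otherwise any color other than \<open>c\<close>. Then
          \<open>e\<close> is still counted, but its neighbor across \<open>j\<close> yields no
          conflict.\<close>
        have "\<exists>c0 \<in> {1..d} - {c}. \<phi> ?e' \<in> {None, Some c, Some c0}"
        proof (cases "\<phi> ?e' \<in> {None, Some c}")
          case True
          have "(if c = 1 then 2 else 1) \<in> {1..d} - {c}" using \<open>d \<ge> 3\<close> by auto
          then show ?thesis using True by blast
        qed (use ran in auto)
        then obtain c0 where c0: "c0 \<in> {1..d}" "c0 \<noteq> c" "\<phi> ?e' \<in> {None, Some c, Some c0}" by blast
        let ?D = "{..<d} - {i0}" and ?C = "{1..d} - {c0}"
        let ?S = "Sigma (colored_in d \<phi> ?D ?C) (\<lambda>p. ?D - {snd p})"
        have "((e, i), j) \<in> ?S" "((e, i), j) \<notin> conflicts d \<phi> ?D ?C"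
          using u j c0 e ran[OF e] \<open>i \<noteq> i0\<close> by (auto simp: conflicts_def colored_in_def)
        then have "conflicts d \<phi> ?D ?C \<subset> ?S" using conflicts_subset by blast
        then have "card (conflicts d \<phi> ?D ?C) < card ?S"
          by (rule psubset_card_mono[rotated]) auto
        also have "\<dots> = card (colored_in d \<phi> ?D ?C) * (d - 2)"
          using i0 by (subst card_Sigma_colored_in) auto
        also have "\<dots> \<le> (d - 1) * (d - 2) * (d - 2)"
          using colored_le[OF c0(1), of "{}" i0] by simp
        finally show ?thesis using reduce[OF i0 c0(1)] empty by simp
      qed
    qed
  qed
qed

end
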